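(* Let $X$ be a Polish space and $(f_n)_n$ a sequence of real-valued Borel functions on $X$ such that the closure $\mathcal K$ of $\{f_n:n\in\mathbb N\}$ in $\mathbb R^X$ (pointwise topology) is compact and every accumulation point of $\mathcal K$ is a Baire-1 function. Then $$\sup\{\alpha(f):f\in \mathrm{Acc}(\mathcal K)\}<\omega_1,$$ where $\mathrm{Acc}(\mathcal K)$ is the set of accumulation points of $\mathcal K$. In particular, if $\mathcal K$ is a separable Rosenthal compact on $X$, then $\sup\{\alpha(f):f\in\mathcal K\}<\omega_1$.
   Context: A Rosenthal compact on a Polish space $X$ is a set of real-valued Baire-1 functions on $X$ compact in the pointwise topology; separable means having a countable dense subset. Separation rank: for $f:X\to\mathbb R$, reals $a<b$ and closed $F\subseteq X$, $F'_{f,a,b}=\overline{F\cap[f<a]}\cap\overline{F\cap[f>b]}$; iterate transfinitely ($F^{(0)}=F$, successor = derivative, intersections at limits); $\alpha(f,F,a,b)$ is the least $\xi$ with $F^{(\xi)}_{f,a,b}=\varnothing$ if one exists below $\omega_1$, else $\omega_1$; $\alpha(f,a,b)=\alpha(f,X,a,b)$ and $\alpha(f)=\sup\{\alpha(f,a,b):a,b\in\mathbb Q,\ a<b\}$. *)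

theory Defs
  imports "HOL-Analysis.Analysis"
begin

text \<open>The space of functions 'a => real carries the product (= pointwise) topology,
  via the instance in HOL-Analysis.Function_Topology.\<close>

definition baire1 :: "('a::topological_space \<Rightarrow> real) \<Rightarrow> bool" where
  "baire1 f \<longleftrightarrow> (\<exists>g :: nat \<Rightarrow> 'a \<Rightarrow> real.
      (\<forall>n. continuous_on UNIV (g n)) \<and> (\<forall>x. (\<lambda>n. g n x) \<longlonglongrightarrow> f x))"

definition rosenthal_compact :: "('a::topological_space \<Rightarrow> real) set \<Rightarrow> bool" where
  "rosenthal_compact K \<longleftrightarrow> (\<forall>f\<in>K. baire1 f) \<and> compact K"

definition separable_set :: "('b::topological_space) set \<Rightarrow> bool" where
  "separable_set K \<longleftrightarrow> (\<exists>D. countable D \<and> D \<subseteq> K \<and> K \<subseteq> closure D)"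

definition sep_deriv :: "('a::topological_space \<Rightarrow> real) \<Rightarrow> real \<Rightarrow> real \<Rightarrow> 'a set \<Rightarrow> 'a set" where
  "sep_deriv f a b F = closure (F \<inter> {x. f x < a}) \<inter> closure (F \<inter> {x. f x > b})"

text \<open>Transfinite iteration along a well-order r (representing the ordinal otp(r)):
  T i is the i-th derived set F^(i); the uniform recursion
  T i = F \<inter> (INT j < i. (T j)') agrees with F^(0)=F, successor = derivative,
  intersections at limits (the derived sets are decreasing).\<close>
definition sep_tower ::
  "(nat \<times> nat) set \<Rightarrow> ('a::topological_space \<Rightarrow> real) \<Rightarrow> real \<Rightarrow> real \<Rightarrow> 'a set \<Rightarrow> (nat \<Rightarrow> 'a set) \<Rightarrow> bool" where
  "sep_tower r f a b F T \<longleftrightarrow>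
     (\<forall>i\<in>Field r. T i = F \<inter> (\<Inter>j\<in>{j. (j, i) \<in> r \<and> j \<noteq> i}. sep_deriv f a b (T j)))"

text \<open>F^(xi)_{f,a,b} = {} where xi is the order type of the countable well-order r;
  equivalently alpha(f,F,a,b) <= xi.\<close>
definition sep_iter_empty ::
  "(nat \<times> nat) set \<Rightarrow> ('a::topological_space \<Rightarrow> real) \<Rightarrow> real \<Rightarrow> real \<Rightarrow> 'a set \<Rightarrow> bool" where
  "sep_iter_empty r f a b F \<longleftrightarrow>
     (\<forall>T. sep_tower r f a b F T \<longrightarrow> F \<inter> (\<Inter>j\<in>Field r. sep_deriv f a b (T j)) = {})"

definition sep_rank_le :: "('a::topological_space \<Rightarrow> real) \<Rightarrow> (nat \<times> nat) set \<Rightarrow> bool" where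
  "sep_rank_le f r \<longleftrightarrow>
     (\<forall>a b. a \<in> \<rat> \<and> b \<in> \<rat> \<and> a < b \<longrightarrow> sep_iter_empty r f a b UNIV)"

end

theory Submission
  imports Defs
begin

text \<open>
  If the rank of \<open>f\<close> for \<open>a < b\<close> is large, then one can build long chains of finite attempts at an
  infinite configuration: points \<open>x\<^sub>0, x\<^sub>1, \<dots>\<close> such that both the points with \<open>f < a\<close> and those with
  \<open>f > b\<close> accumulate at every \<open>x\<^sub>i\<close>, and indices \<open>n\<^sub>0 < n\<^sub>1 < \<dots>\<close> for which \<open>f\<^bsub>n\<^sub>l\<^esub>\<close> already lies on the
  right side of \<open>a\<close> or \<open>b\<close> at every \<open>x\<^sub>i\<close> with \<open>i \<le> l\<close>. An infinite configuration cannot exist: a cluster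
  point of \<open>(f\<^bsub>n\<^sub>l\<^esub>)\<close> is \<open>\<le> a\<close> and \<open>\<ge> b\<close> on two dense subsets of \<open>closure {x\<^sub>i}\<close>, which the Baire category
  theorem forbids for a Baire-1 function. Writing the Borel sets \<open>[f\<^sub>n < a]\<close> and \<open>[f\<^sub>n > b]\<close> as projections of
  closed subsets of \<open>X \<times> \<nat>\<^sup>\<nat>\<close>, an attempt only needs to be remembered through a finite list of natural
  numbers, so the attempts form a well-founded countable tree that does not depend on \<open>f\<close>. Any
  well-order of \<open>\<nat>\<close> extending this tree bounds all the ranks.
\<close>

subsection \<open>Separation in function spaces\<close>

lemma open_coordinate_vimage: "open U \<Longrightarrow> open {f :: 'a \<Rightarrow> 'b::topological_space. f i \<in> U}"
  using product_topology_basis'[of "{i}" "\<lambda>_. U" "\<lambda>i. i"] by simp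

text \<open>The separation axioms serve two purposes: T1 for the handling of accumulation points,
  and Hausdorff so that compact sets of functions are closed.\<close>

instance "fun" :: (type, t0_space) t0_space
proof
  fix f g :: "'a \<Rightarrow> 'b" assume "f \<noteq> g"
  then obtain i where "f i \<noteq> g i" by blast
  then obtain U where "open U" "\<not> (f i \<in> U \<longleftrightarrow> g i \<in> U)"
    by (auto simp: separation_t0)
  then show "\<exists>U. open U \<and> \<not> (f \<in> U \<longleftrightarrow> g \<in> U)"
    by (intro exI[of _ "{h. h i \<in> U}"]) (simp add: open_coordinate_vimage)
qed

instance "fun" :: (type, t1_space) t1_space
proof
  fix f g :: "'a \<Rightarrow> 'b" assume "f \<noteq> g"
  then obtain i where "f i \<noteq> g i" by blast
  then obtain U where "open U" "f i \<in> U" "g i \<notin> U"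
    by (auto simp: separation_t1)
  then show "\<exists>U. open U \<and> f \<in> U \<and> g \<notin> U"
    by (intro exI[of _ "{h. h i \<in> U}"]) (simp add: open_coordinate_vimage)
qed

instance "fun" :: (type, t2_space) t2_space
proof
  fix f g :: "'a \<Rightarrow> 'b" assume "f \<noteq> g"
  then obtain i where "f i \<noteq> g i" by blast
  then obtain U V where "open U" "open V" "f i \<in> U" "g i \<in> V" "U \<inter> V = {}"
    by (meson hausdorff)
  then show "\<exists>U V. open U \<and> open V \<and> f \<in> U \<and> g \<in> V \<and> U \<inter> V = {}"
    by (intro exI[of _ "{h. h i \<in> U}"] exI[of _ "{h. h i \<in> V}"])
      (auto intro: open_coordinate_vimage)
qed

lemma tendsto_fun:
  fixes f :: "'c \<Rightarrow> 'a \<Rightarrow> 'b::topological_space"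
  assumes "\<And>i. ((\<lambda>n. f n i) \<longlongrightarrow> l i) F"
  shows "(f \<longlongrightarrow> l) F"
proof -
  have "limitin (product_topology (\<lambda>_. euclidean) UNIV) f l F"
    using assms by (simp add: limitin_componentwise)
  then show ?thesis by (simp add: euclidean_product_topology)
qed

text \<open>In a T1 space \<open>U - {x}\<close> is open, so it meets \<open>closure S\<close> only
  if it meets \<open>S\<close>.\<close>

lemma islimpt_closure_iff: "x islimpt closure S \<longleftrightarrow> x islimpt S" for x :: "'b::t1_space"
proof
  assume lim: "x islimpt closure S"
  show "x islimpt S"
  proof (rule islimptI)
    fix U assume U: "x \<in> U" "open U"
    then obtain y where "y \<in> closure S" "y \<in> U" "y \<noteq> x"
      using islimptE[OF lim U] by blast
    then have "(U - {x}) \<inter> closure S \<noteq> {}" by blast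
    then have "(U - {x}) \<inter> S \<noteq> {}"
      using open_Int_closure_eq_empty[of "U - {x}" S] U(2) by (simp add: open_delete)
    then show "\<exists>y\<in>S. y \<in> U \<and> y \<noteq> x" by blast
  qed
qed (rule islimpt_subset[OF _ closure_subset])

subsection \<open>Cluster points of sequences\<close>

text \<open>Indices are counted, not values: a value taken infinitely often is a cluster point even
  if it is isolated. This lets one theorem serve both assertions.\<close>

definition cluster_points :: "(nat \<Rightarrow> 'b::topological_space) \<Rightarrow> 'b set" where
  "cluster_points s = {l. \<forall>U. open U \<longrightarrow> l \<in> U \<longrightarrow> infinite {n. s n \<in> U}}"

lemma cluster_point_in_closure: "l \<in> cluster_points s \<Longrightarrow> l \<in> closure (range s)"
  unfolding cluster_points_def closure_iff_nhds_not_empty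
  by (force dest: infinite_imp_nonempty)

text \<open>Compactness is used through filters because the function space need not be first
  countable, so a convergent subsequence may not exist.\<close>

lemma compact_cluster_point:
  assumes "compact K" "\<And>n. s n \<in> K"
  obtains l where "l \<in> K" "l \<in> cluster_points s"
proof -
  have "\<forall>\<^sub>F l in filtermap s sequentially. l \<in> K"
    using assms(2) by (simp add: eventually_filtermap)
  moreover have "filtermap s sequentially \<noteq> bot" by (simp add: filtermap_bot_iff)
  ultimately have "\<exists>l\<in>K. inf (nhds l) (filtermap s sequentially) \<noteq> bot"
    using assms(1) unfolding compact_filter by blast
  then obtain l where l: "l \<in> K" "inf (nhds l) (filtermap s sequentially) \<noteq> bot" by blast
  have "infinite {n. s n \<in> U}" if U: "open U" "l \<in> U" for U
  proof
    assume "finite {n. s n \<in> U}"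
    then have "\<forall>\<^sub>F n in sequentially. s n \<notin> U"
      by (simp add: cofinite_eq_sequentially[symmetric] eventually_cofinite)
    then have "\<forall>\<^sub>F g in filtermap s sequentially. g \<notin> U" by (simp add: eventually_filtermap)
    moreover have "\<forall>\<^sub>F g in nhds l. g \<in> U" using U by (rule eventually_nhds_in_open)
    ultimately have "\<forall>\<^sub>F g in inf (nhds l) (filtermap s sequentially). False"
      by (auto simp: eventually_inf)
    then show False using l(2) by (simp add: eventually_False)
  qed
  then show ?thesis using that l(1) by (auto simp: cluster_points_def)
qed

lemma cluster_points_subseq:
  assumes "strict_mono n" "l \<in> cluster_points (s \<circ> n)"
  shows "l \<in> cluster_points s"
proof -
  have "infinite {k. s k \<in> U}" if "infinite {k. s (n k) \<in> U}" for U
  proof -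
    have "infinite (n ` {k. s (n k) \<in> U})"
      using that assms(1) by (meson finite_imageD inj_on_subset strict_mono_imp_inj_on subset_UNIV)
    then show ?thesis by (rule infinite_super[rotated]) auto
  qed
  then show ?thesis using assms(2) by (auto simp: cluster_points_def)
qed

subsection \<open>Analytic sets\<close>

definition analytic_set :: "'a::topological_space set \<Rightarrow> bool" where
  "analytic_set A \<longleftrightarrow> (\<exists>C :: ('a \<times> (nat \<Rightarrow> nat)) set. closed C \<and> A = fst ` C)"

lemma analytic_set_closed:
  assumes "closed A" shows "analytic_set A"
  unfolding analytic_set_def
  by (rule exI[of _ "A \<times> UNIV"]) (simp add: assms closed_Times)

lemma analytic_set_UN:
  fixes A :: "nat \<Rightarrow> 'a::topological_space set"
  assumes "\<And>n. analytic_set (A n)"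
  shows "analytic_set (\<Union>n. A n)"
proof -
  obtain C :: "nat \<Rightarrow> ('a \<times> (nat \<Rightarrow> nat)) set"
    where C: "\<And>n. closed (C n)" "\<And>n. A n = fst ` C n"
    using assms unfolding analytic_set_def by metis
  \<comment> \<open>Entry 0 of the witness selects a member of the union; the remaining entries are
    the witness for it.\<close>
  define D where "D = {p. (fst p, \<lambda>k. snd p (Suc k)) \<in> C (snd p 0)}"
  have shift: "continuous_on UNIV (\<lambda>p :: 'a \<times> (nat \<Rightarrow> nat). (fst p, \<lambda>k. snd p (Suc k)))"
    by (intro continuous_intros continuous_on_product_then_coordinatewise)
  have head: "continuous_on UNIV (\<lambda>p :: 'a \<times> (nat \<Rightarrow> nat). snd p 0)"
    by (intro continuous_intros continuous_on_product_then_coordinatewise)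
  have "- D = (\<Union>n. ((\<lambda>p. snd p 0) -` {n}) \<inter> ((\<lambda>p. (fst p, \<lambda>k. snd p (Suc k))) -` (- C n)))"
    by (auto simp: D_def)
  also have "open \<dots>"
    using C(1) by (intro open_UN open_Int ballI open_vimage[OF _ shift] open_vimage[OF _ head])
      (auto simp: open_discrete)
  finally have "closed D" by (simp add: closed_def)
  moreover have "(\<Union>n. A n) = fst ` D"
  proof (intro equalityI subsetI)
    fix x assume "x \<in> (\<Union>n. A n)"
    then obtain n z where "(x, z) \<in> C n" using C(2) by force
    then have "(x, \<lambda>k. case k of 0 \<Rightarrow> n | Suc k \<Rightarrow> z k) \<in> D" by (simp add: D_def)
    then show "x \<in> fst ` D" by force
  next
    fix x assume "x \<in> fst ` D"
    then show "x \<in> (\<Union>n. A n)" using C(2) by (force simp: D_def)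
  qed
  ultimately show ?thesis unfolding analytic_set_def by blast
qed

lemma analytic_set_INT:
  fixes A :: "nat \<Rightarrow> 'a::topological_space set"
  assumes "\<And>n. analytic_set (A n)"
  shows "analytic_set (\<Inter>n. A n)"
proof -
  obtain C :: "nat \<Rightarrow> ('a \<times> (nat \<Rightarrow> nat)) set"
    where C: "\<And>n. closed (C n)" "\<And>n. A n = fst ` C n"
    using assms unfolding analytic_set_def by metis
  \<comment> \<open>One sequence codes a witness for every \<open>n\<close> at once, by
    pairing.\<close>
  define D where "D = (\<Inter>n. (\<lambda>p. (fst p, \<lambda>k. snd p (prod_encode (n, k)))) -` C n)"
  have "continuous_on UNIV (\<lambda>p :: 'a \<times> (nat \<Rightarrow> nat). (fst p, \<lambda>k. snd p (prod_encode (n, k))))" for n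
    by (intro continuous_intros continuous_on_product_then_coordinatewise)
  then have "closed D"
    unfolding D_def using C(1)
    by (intro closed_INT ballI) (simp add: continuous_on_closed_vimage[OF closed_UNIV])
  moreover have "(\<Inter>n. A n) = fst ` D"
  proof (intro equalityI subsetI)
    fix x assume "x \<in> (\<Inter>n. A n)"
    then have "\<exists>z. (x, z) \<in> C n" for n using C(2) by force
    then obtain z where "\<And>n. (x, z n) \<in> C n" by metis
    then have "(x, \<lambda>p. case_prod z (prod_decode p)) \<in> D" by (simp add: D_def)
    then show "x \<in> fst ` D" by force
  next
    fix x assume "x \<in> fst ` D"
    then show "x \<in> (\<Inter>n. A n)" using C(2) by (force simp: D_def)
  qed
  ultimately show ?thesis unfolding analytic_set_def by blast
qed

lemma analytic_set_open:
  fixes U :: "'a::metric_space set"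
  assumes "open U" shows "analytic_set U"
proof -
  define A where "A n = (\<Inter>y\<in>-U. {x. inverse (real (Suc n)) \<le> dist x y})" for n
  have "closed (A n)" for n
    unfolding A_def by (intro closed_INT ballI closed_Collect_le continuous_intros)
  then have "analytic_set (\<Union>n. A n)" by (intro analytic_set_UN analytic_set_closed)
  also have "(\<Union>n. A n) = U"
  proof (intro equalityI subsetI)
    fix x assume "x \<in> (\<Union>n. A n)"
    then show "x \<in> U" by (force simp: A_def)
  next
    fix x assume "x \<in> U"
    then obtain e where e: "e > 0" "ball x e \<subseteq> U" using assms openE by blast
    obtain n where "inverse (real (Suc n)) < e" using reals_Archimedean e(1) by blast
    with e(2) have "x \<in> A n" by (force simp: A_def subset_iff not_le)
    then show "x \<in> (\<Union>n. A n)" by blast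
  qed
  finally show ?thesis .
qed

lemma analytic_set_borel:
  fixes A :: "'a::metric_space set"
  assumes "A \<in> sets borel" shows "analytic_set A"
proof -
  have "A \<in> sigma_sets UNIV {S. open S}" using assms by (simp add: borel_def)
  \<comment> \<open>Analytic sets are not closed under complements in general, so the induction
    carries the complement along.\<close>
  then have "analytic_set A \<and> analytic_set (- A)"
  proof induction
    case (Basic S)
    then show ?case by (simp add: analytic_set_open analytic_set_closed closed_Compl)
  next
    case Empty
    then show ?case by (simp add: analytic_set_closed)
  next
    case (Compl S)
    then show ?case by (simp add: Compl_eq_Diff_UNIV[symmetric])
  next
    case (Union S)
    then show ?case by (auto intro: analytic_set_UN analytic_set_INT)
  qed
  then show ?thesis ..
qed

subsection \<open>Baire-1 functions\<close>

lemma baire1_borel_measurable: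
  fixes f :: "'a::topological_space \<Rightarrow> real"
  assumes "baire1 f" shows "f \<in> borel_measurable borel"
proof -
  obtain g where g: "\<And>n. continuous_on UNIV (g n)" "\<And>x. (\<lambda>n. g n x) \<longlonglongrightarrow> f x"
    using assms unfolding baire1_def by blast
  have "g n \<in> borel_measurable borel" for n
    using g(1) by (rule borel_measurable_continuous_onI)
  then show ?thesis
    by (rule borel_measurable_LIMSEQ_real[rotated]) (rule g(2))
qed

text \<open>Baire category in \<open>closure S\<close>: countably many relatively closed sets, each
  inside [f \<le> d] or [f \<ge> c], cover it. One would contain a nonempty relatively open set, but
  every such set contains points of \<open>S\<close> of both kinds.\<close>

lemma baire1_not_densely_separated:
  fixes f :: "'a::complete_space \<Rightarrow> real"
  assumes f: "baire1 f" and "a < b" and "S \<noteq> {}"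
    and S: "S \<subseteq> closure {x \<in> S. f x \<le> a}" "S \<subseteq> closure {x \<in> S. f x \<ge> b}"
  shows False
proof -
  obtain g where g: "\<And>n. continuous_on UNIV (g n)" "\<And>x. (\<lambda>n. g n x) \<longlonglongrightarrow> f x"
    using f unfolding baire1_def by blast
  \<comment> \<open>Since c < d, every value is < d or > c. Such a strict inequality holds
    eventually for \<open>g n x\<close>, which gives the cover.\<close>
  obtain c where c: "a < c" "c < b" using \<open>a < b\<close> dense by blast
  obtain d where d: "c < d" "d < b" using c dense by blast
  define X where "X = top_of_set (closure S)"
  define A where "A n = closure S \<inter> (\<Inter>m\<in>{n..}. {x. g m x \<le> d})" for n
  define B where "B n = closure S \<inter> (\<Inter>m\<in>{n..}. {x. c \<le> g m x})" for n
  have lim_A: "f x \<le> d" if "x \<in> A n" for x n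
    using that by (intro LIMSEQ_le_const2[OF g(2)]) (auto simp: A_def)
  have lim_B: "c \<le> f x" if "x \<in> B n" for x n
    using that by (intro LIMSEQ_le_const[OF g(2)]) (auto simp: B_def)
  have closed: "closed (A n)" "closed (B n)" for n
    unfolding A_def B_def using g(1)
    by (auto intro!: closed_Int closed_INT closed_Collect_le continuous_intros)
  have no_open: "S \<inter> U = {}" if "open U" "closure S \<inter> U \<subseteq> A n \<or> closure S \<inter> U \<subseteq> B n" for U n
  proof (rule ccontr)
    assume "S \<inter> U \<noteq> {}"
    then have "U \<inter> closure {x \<in> S. f x \<le> a} \<noteq> {}" "U \<inter> closure {x \<in> S. f x \<ge> b} \<noteq> {}"
      using S by blast+
    then obtain y z where yz: "y \<in> S" "y \<in> U" "f y \<le> a" "z \<in> S" "z \<in> U" "f z \<ge> b"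
      unfolding open_Int_closure_eq_empty[OF \<open>open U\<close>] by blast
    then have "y \<in> closure S \<inter> U" "z \<in> closure S \<inter> U" using closure_subset by blast+
    then show False
      using that(2) lim_A[of z n] lim_B[of y n] c d yz by fastforce
  qed
  have int: "X interior_of T = {}" if T: "T \<in> range A \<union> range B" for T
  proof (rule ccontr)
    assume "X interior_of T \<noteq> {}"
    then obtain V x where V: "openin X V" "V \<subseteq> T" "x \<in> V"
      by (auto simp: interior_of_def)
    then obtain U where U: "open U" "V = closure S \<inter> U" by (auto simp: X_def openin_open)
    then have "S \<inter> U \<noteq> {}" using V(3) open_Int_closure_eq_empty[OF U(1), of S] by blast
    then show False using no_open[OF U(1)] V(2) U(2) T by blast
  qed
  have "completely_metrizable_space (Met_TC.mtopology :: 'a topology)"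
    by (rule Met_TC.completely_metrizable_space_mtopology)
      (simp add: mcomplete_iff_complete complete_UNIV)
  then have "completely_metrizable_space X"
    by (simp add: X_def mtopology_is_euclidean completely_metrizable_space_closedin)
  then have "X interior_of \<Union>(range A \<union> range B) = {}"
    using int closed
    by (intro Baire_category_alt) (auto simp: X_def A_def B_def closedin_closed_eq)
  moreover have "\<Union>(range A \<union> range B) = closure S"
  proof
    show "\<Union>(range A \<union> range B) \<subseteq> closure S" by (auto simp: A_def B_def)
    show "closure S \<subseteq> \<Union>(range A \<union> range B)"
    proof
      fix x assume x: "x \<in> closure S"
      show "x \<in> \<Union>(range A \<union> range B)"
      proof (cases "f x < d")
        case True
        then have "\<forall>\<^sub>F n in sequentially. g n x < d" by (rule order_tendstoD(2)[OF g(2)])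
        then show ?thesis using x by (force simp: eventually_sequentially A_def)
      next
        case False
        then have "\<forall>\<^sub>F n in sequentially. c < g n x"
          using d by (intro order_tendstoD(1)[OF g(2)]) auto
        then show ?thesis using x by (force simp: eventually_sequentially B_def)
      qed
    qed
  qed
  ultimately have "closure S = {}"
    by (metis X_def interior_of_topspace topspace_euclidean_subtopology)
  then show False using \<open>S \<noteq> {}\<close> by simp
qed

subsection \<open>Well-founded relations and well-orders\<close>

text \<open>Compares the ranks of two points of a well-founded relation without assigning ordinals.\<close>

inductive rank_le :: "('a \<times> 'a) set \<Rightarrow> 'a \<Rightarrow> 'a \<Rightarrow> bool" for R where
  "(\<And>x'. (x', x) \<in> R \<Longrightarrow> \<exists>y'. (y', y) \<in> R \<and> rank_le R x' y') \<Longrightarrow> rank_le R x y"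

lemma rank_le_step: "rank_le R x y \<Longrightarrow> (x', x) \<in> R \<Longrightarrow> \<exists>y'. (y', y) \<in> R \<and> rank_le R x' y'"
  by (erule rank_le.cases) blast

text \<open>Trichotomy of ranks: the second alternative expresses that the rank of \<open>y\<close>
  is strictly below that of \<open>x\<close>.\<close>

lemma rank_le_total_aux:
  assumes "wf R"
  shows "rank_le R x y \<or> (\<exists>x'. (x', x) \<in> R \<and> rank_le R y x')"
  using assms
proof (induction x arbitrary: y)
  case (less x)
  show ?case
  proof (rule disjCI)
    assume "\<not> (\<exists>x'. (x', x) \<in> R \<and> rank_le R y x')"
    then have no: "\<not> rank_le R y x'" if "(x', x) \<in> R" for x' using that by blast
    show "rank_le R x y"
    proof
      fix x' assume x': "(x', x) \<in> R"
      then obtain y' where "(y', y) \<in> R" "\<not> (\<exists>x''. (x'', x') \<in> R \<and> rank_le R y' x'')"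
        using no[OF x'] rank_le.intros[of y R x'] by blast
      then show "\<exists>y'. (y', y) \<in> R \<and> rank_le R x' y'" using less[OF x', of y'] by blast
    qed
  qed
qed

lemma rank_le_trans: "rank_le R x y \<Longrightarrow> rank_le R y z \<Longrightarrow> rank_le R x z"
proof (induction arbitrary: z rule: rank_le.induct)
  case (1 x y)
  show ?case by (rule rank_le.intros) (metis 1 rank_le_step)
qed

lemma rank_le_of_rel:
  assumes "wf R" "(x', x) \<in> R"
  shows "rank_le R x' x"
  using assms
proof (induction x' arbitrary: x)
  case (less x')
  then show ?case by (intro rank_le.intros) blast
qed

lemma rank_le_strict:
  assumes "wf R" "(x', x) \<in> R"
  shows "\<not> rank_le R x x'"
  using assms
proof (induction x' arbitrary: x)
  case (less x')
  then show ?case using rank_le_step[of R x x' x'] by blast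
qed

lemma wf_rank_less:
  assumes "wf R"
  shows "wf {(x, y). \<not> rank_le R y x}"
proof -
  \<comment> \<open>The claim covers all \<open>x\<close> of rank at most that of \<open>y\<close>:
    a point of smaller rank than \<open>x\<close> has rank at most that of some
    \<open>R\<close>-predecessor of \<open>y\<close>, so the induction hypothesis applies to
    it.\<close>
  have "\<forall>x. rank_le R x y \<longrightarrow> x \<in> Wellfounded.acc {(x, y). \<not> rank_le R y x}" for y
    using assms
  proof (induction y)
    case (less y)
    show ?case
    proof (intro allI impI, rule accI)
      fix x z assume "rank_le R x y" and "(z, x) \<in> {(x, y). \<not> rank_le R y x}"
      then have "\<not> rank_le R x z" by simp
      then obtain x' where "(x', x) \<in> R" "rank_le R z x'"
        using rank_le_total_aux[OF assms] by blast
      moreover then obtain y' where "(y', y) \<in> R" "rank_le R x' y'"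
        using \<open>rank_le R x y\<close> rank_le_step by metis
      ultimately show "z \<in> Wellfounded.acc {(x, y). \<not> rank_le R y x}"
        using less[of y'] rank_le_trans by metis
    qed
  qed
  moreover have "rank_le R x x" for x
    using rank_le_total_aux[OF assms, of x x] rank_le_strict[OF assms] by blast
  ultimately have "\<forall>x. x \<in> Wellfounded.acc {(x, y). \<not> rank_le R y x}" by blast
  then show ?thesis by (rule acc_wfI)
qed

text \<open>Points are ordered by rank, and within a rank by the usual order of the naturals. Rank
  strictly increases along \<open>R\<close>, so \<open>R\<close> is contained in the result.\<close>

lemma wf_extends_to_Well_order:
  fixes R :: "(nat \<times> nat) set"
  assumes R: "wf R"
  obtains r where "Well_order r" "R \<subseteq> r - Id" "Field r = UNIV"
proof
  define lt where "lt = {(x, y). \<not> rank_le R y x}"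
  \<comment> \<open>A canonical representative of the rank class; equal ranks become equal first
    components of the lexicographic order.\<close>
  define c where "c x = (LEAST z. rank_le R x z \<and> rank_le R z x)" for x
  define s where "s = inv_image (lt <*lex*> less_than) (\<lambda>x. (c x, x))"
  have total: "rank_le R x y \<or> rank_le R y x" for x y
    using rank_le_total_aux[OF R, of x y] rank_le_of_rel[OF R] rank_le_trans by metis
  then have "rank_le R x x" for x by blast
  then have c: "rank_le R x (c x) \<and> rank_le R (c x) x" for x
    unfolding c_def using LeastI[of "\<lambda>z. rank_le R x z \<and> rank_le R z x" x] by simp
  have c_eq: "c x = c y" if "rank_le R (c x) (c y)" "rank_le R (c y) (c x)" for x y
  proof -
    have "rank_le R x z \<and> rank_le R z x \<longleftrightarrow> rank_le R y z \<and> rank_le R z y" for z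
      using that c rank_le_trans by metis
    then show ?thesis by (simp add: c_def)
  qed
  have wf_s: "wf s"
    using wf_rank_less[OF R] by (simp add: s_def lt_def wf_lex_prod)
  have "trans lt"
    unfolding lt_def by (intro transI) (metis case_prodD case_prodI mem_Collect_eq rank_le_trans total)
  then have "trans s" by (simp add: s_def trans_inv_image trans_lex_prod)
  then have "trans (s\<^sup>=)" unfolding trans_def by blast
  moreover have "antisym (s\<^sup>=)" using wf_not_sym[OF wf_s] by (auto intro!: antisymI)
  moreover have "(x, y) \<in> s \<or> (y, x) \<in> s" if "x \<noteq> y" for x y
    using that c_eq[of x y] by (auto simp: s_def lt_def)
  moreover have "Field (s\<^sup>=) = UNIV" by (auto simp: Field_def)
  ultimately have "Linear_order (s\<^sup>=)"
    by (simp add: linear_order_on_def partial_order_on_def preorder_on_def total_on_def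
        refl_on_def)
  moreover have "wf (s\<^sup>= - Id)" by (rule wf_subset[OF wf_s]) auto
  ultimately show "Well_order (s\<^sup>=)" by (simp add: well_order_on_def)
  show "R \<subseteq> s\<^sup>= - Id"
  proof
    fix p assume "p \<in> R"
    then obtain x y where p: "p = (x, y)" "(x, y) \<in> R" by (cases p) auto
    then have "\<not> rank_le R y x" using rank_le_strict[OF R] by blast
    then have "\<not> rank_le R (c y) (c x)" using c rank_le_trans by metis
    then have "(c x, c y) \<in> lt" by (simp add: lt_def)
    then have "(x, y) \<in> s" by (simp add: s_def)
    moreover have "x \<noteq> y" using p R by auto
    ultimately show "p \<in> s\<^sup>= - Id" by (simp add: p)
  qed
  show "Field (s\<^sup>=) = UNIV" by (auto simp: Field_def)
qed

text \<open>A descending chain keeps \<open>p\<close> and adds one entry at a time, so it spells an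
  infinite sequence \<open>w\<close>. The chain may start at any list, so only long prefixes of
  \<open>w\<close> are known to satisfy \<open>T p\<close>; hence the hypothesis asks for
  arbitrarily long bad prefixes.\<close>

lemma wf_list_extension:
  fixes T :: "'p \<Rightarrow> 'b list \<Rightarrow> bool"
  assumes "\<And>p w. \<exists>\<^sub>F k in sequentially. \<not> T p (map w [0..<k])"
  shows "wf {((p, s @ [c]), (p, s)) | p s c. T p (s @ [c])}"
  unfolding wf_iff_no_infinite_down_chain
proof
  assume "\<exists>g. \<forall>i. (g (Suc i), g i) \<in> {((p, s @ [c]), (p, s)) | p s c. T p (s @ [c])}"
  then obtain g :: "nat \<Rightarrow> 'p \<times> 'b list" where
    g: "\<And>i. (g (Suc i), g i) \<in> {((p, s @ [c]), (p, s)) | p s c. T p (s @ [c])}" by blast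
  define p where "p = fst (g 0)"
  define s where "s i = snd (g i)" for i
  have step: "fst (g (Suc i)) = fst (g i) \<and> (\<exists>c. s (Suc i) = s i @ [c]) \<and> T (fst (g i)) (s (Suc i))" for i
    using g[of i] by (auto simp: s_def)
  have p: "fst (g i) = p" for i
    by (induction i) (auto simp: p_def step)
  have len: "length (s i) = length (s 0) + i" for i
  proof (induction i)
    case (Suc i)
    then show ?case using step[of i] by auto
  qed simp
  have prefix: "s (i + n) ! j = s i ! j" if "j < length (s i)" for i n j
  proof (induction n)
    case (Suc n)
    have "j < length (s (i + n))" using that len[of i] len[of "i + n"] by simp
    then show ?case using Suc step[of "i + n"] by (auto simp: nth_append)
  qed simp
  define w where "w j = s (Suc j) ! j" for j
  have "map w [0..<length (s 0) + i] = s i" for i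
  proof (rule nth_equalityI)
    fix j assume "j < length (map w [0..<length (s 0) + i])"
    then have j: "j < length (s i)" "j < length (s (Suc j))"
      using len[of i] len[of "Suc j"] by auto
    have "s (max i (Suc j)) ! j = s i ! j" "s (max i (Suc j)) ! j = s (Suc j) ! j"
      using prefix[OF j(1), of "max i (Suc j) - i"] prefix[OF j(2), of "max i (Suc j) - Suc j"]
      by simp_all
    then show "map w [0..<length (s 0) + i] ! j = s i ! j" using j len[of i] by (simp add: w_def)
  qed (simp add: len[of i])
  moreover have "T p (s (Suc i))" for i using step[of i] p by simp
  ultimately have "T p (map w [0..<k])" if "k \<ge> Suc (length (s 0))" for k
    using that by (metis add_Suc_shift le_iff_add)
  then have "\<forall>\<^sub>F k in sequentially. T p (map w [0..<k])"
    by (auto simp: eventually_sequentially)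
  then show False using assms[of p w] by (simp add: frequently_def)
qed

subsection \<open>Finite attempts\<close>

text \<open>
  A point sequence is built so that point \<open>Suc (prod_encode (i, m))\<close> is within \<open>1 / (m + 1)\<close> of
  point \<open>i\<close> and lies in \<open>[f < a]\<close> if \<open>m\<close> is even, in \<open>[f > b]\<close> if \<open>m\<close> is odd. Hence in an infinite
  run both kinds of points accumulate at every point.
\<close>

definition below :: "nat \<Rightarrow> bool" where
  "below k = (case k of 0 \<Rightarrow> True | Suc j \<Rightarrow> even (snd (prod_decode j)))"

definition side :: "real \<Rightarrow> real \<Rightarrow> nat \<Rightarrow> real set" where
  "side a b i = (if below i then {..<a} else {b<..})"

text \<open>
  The data of stage \<open>l\<close> is packed into one sequence \<open>W l\<close>: the index of the function chosen at this
  stage, the indices of dense points converging to the point chosen at this stage, and for each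
  \<open>i \<le> l\<close> a witness that point \<open>i\<close> lies in the analytic set prescribed by the chosen function.
\<close>

definition stage_index :: "(nat \<Rightarrow> nat) \<Rightarrow> nat" where "stage_index u = u 0"
definition stage_center :: "(nat \<Rightarrow> nat) \<Rightarrow> nat \<Rightarrow> nat" where
  "stage_center u m = u (Suc (prod_encode (0, m)))"
definition stage_witness :: "(nat \<Rightarrow> nat) \<Rightarrow> nat \<Rightarrow> nat \<Rightarrow> nat" where
  "stage_witness u i j = u (Suc (prod_encode (Suc i, j)))"

lemma stage_exists:
  obtains u where "stage_index u = n" "stage_center u = q" "stage_witness u = z"
proof
  let ?u = "\<lambda>p. case p of 0 \<Rightarrow> n
    | Suc p \<Rightarrow> (case prod_decode p of (0, m) \<Rightarrow> q m | (Suc i, j) \<Rightarrow> z i j)"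
  show "stage_index ?u = n" "stage_center ?u = q" "stage_witness ?u = z"
    by (auto simp: stage_index_def stage_center_def stage_witness_def fun_eq_iff)
qed

text \<open>The first clause makes \<open>W i\<close> determine \<open>x i\<close> for
  \<open>i < k\<close>. For fixed \<open>W\<close> and closed sets \<open>C i n\<close> all clauses
  are closed conditions on the points, so they survive limits. Later \<open>C i n\<close> projects
  onto the set where the \<open>n\<close>-th function is on side \<open>i\<close>.\<close>

definition attempt ::
  "(nat \<Rightarrow> 'a::metric_space) \<Rightarrow> (nat \<Rightarrow> nat \<Rightarrow> ('a \<times> (nat \<Rightarrow> nat)) set) \<Rightarrow> nat
    \<Rightarrow> (nat \<Rightarrow> nat \<Rightarrow> nat) \<Rightarrow> (nat \<Rightarrow> 'a) \<Rightarrow> bool" where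
  "attempt e C k W x \<longleftrightarrow>
    (\<forall>i<k. \<forall>m. dist (x i) (e (stage_center (W i) m)) \<le> (1/2) ^ m) \<and>
    (\<forall>l<k. \<forall>i<l. stage_index (W i) < stage_index (W l)) \<and>
    (\<forall>l<k. \<forall>i\<le>l. (x i, stage_witness (W l) i) \<in> C i (stage_index (W l))) \<and>
    (\<forall>j. Suc j < k \<longrightarrow>
      dist (x (Suc j)) (x (fst (prod_decode j))) \<le> inverse (real (Suc (snd (prod_decode j)))))"

text \<open>
  Entry \<open>prod_encode (l, j) \<ge> l\<close> belongs to stage \<open>l\<close>, so the first \<open>k\<close> entries depend only on the
  first \<open>k\<close> stages.
\<close>

definition transcript :: "(nat \<Rightarrow> nat \<Rightarrow> nat) \<Rightarrow> nat \<Rightarrow> nat list" where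
  "transcript W k = map (\<lambda>p. case_prod W (prod_decode p)) [0..<k]"

lemma transcript_upd: "take k (transcript (W(k := u)) (Suc k)) = transcript W k"
proof -
  have "(W(k := u)) (fst (prod_decode p)) = W (fst (prod_decode p))" if "p < k" for p
    using that le_prod_encode_1[of "fst (prod_decode p)" "snd (prod_decode p)"] by auto
  then show ?thesis by (simp add: transcript_def case_prod_unfold)
qed

text \<open>Old points and old stages are kept. Only stage \<open>k\<close> is new: its function
  must be on the right side at all of the points 0 to \<open>k\<close>, and its index must exceed
  the earlier ones.\<close>

lemma attempt_extend:
  assumes W: "attempt e C k W x"
    and x': "x' = x(k := y)" and e: "closure (range e) = UNIV"
    and near: "\<And>j. k = Suc j \<Longrightarrow>
      dist y (x (fst (prod_decode j))) \<le> inverse (real (Suc (snd (prod_decode j))))"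
    and n: "\<And>N. \<exists>n>N. \<forall>i\<le>k. x' i \<in> fst ` C i n"
  shows "\<exists>W'. attempt e C (Suc k) W' x' \<and> take k (transcript W' (Suc k)) = transcript W k"
proof -
  \<comment> \<open>The old value \<open>W k\<close> is included only to keep the set nonempty when
    \<open>k = 0\<close>.\<close>
  obtain n where n: "n > Max (stage_index ` W ` {..k})" "\<forall>i\<le>k. x' i \<in> fst ` C i n"
    using n by blast
  have "\<exists>z. i \<le> k \<longrightarrow> (x' i, z) \<in> C i n" for i using n(2) by force
  then obtain z where z: "\<And>i. i \<le> k \<Longrightarrow> (x' i, z i) \<in> C i n" by metis
  have "\<exists>j. dist y (e j) \<le> (1/2) ^ m" for m
  proof -
    have "y \<in> closure (range e)" using e by simp
    then obtain j where "dist (e j) y < (1/2) ^ m"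
      unfolding closure_approachable by (metis imageE zero_less_divide_1_iff zero_less_numeral zero_less_power)
    then show ?thesis by (auto simp: dist_commute intro: less_imp_le)
  qed
  then obtain q where q: "\<And>m. dist y (e (q m)) \<le> (1/2) ^ m" by metis
  obtain u where u: "stage_index u = n" "stage_center u = q" "stage_witness u = z"
    by (rule stage_exists)
  have less: "stage_index (W i) < n" if "i \<le> k" for i
    using n(1) that by (simp add: Max_less_iff)
  have decode: "fst (prod_decode j) \<le> j" for j
    using le_prod_encode_1[of "fst (prod_decode j)" "snd (prod_decode j)"] by simp
  have "attempt e C (Suc k) (W(k := u)) x'"
    unfolding attempt_def
  proof (intro conjI allI impI)
    fix i m assume "i < Suc k"
    then show "dist (x' i) (e (stage_center ((W(k := u)) i) m)) \<le> (1/2) ^ m"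
      using W q u by (auto simp: attempt_def x' less_Suc_eq)
  next
    fix i l assume "l < Suc k" "i < l"
    then show "stage_index ((W(k := u)) i) < stage_index ((W(k := u)) l)"
      using W less u by (auto simp: attempt_def less_Suc_eq)
  next
    fix i l assume l: "l < Suc k" "i \<le> l"
    show "(x' i, stage_witness ((W(k := u)) l) i) \<in> C i (stage_index ((W(k := u)) l))"
    proof (cases "l = k")
      case True
      then show ?thesis using z l u by simp
    next
      case False
      then show ?thesis using W l by (auto simp: attempt_def x')
    qed
  next
    fix j assume j: "Suc j < Suc k"
    have "x' (fst (prod_decode j)) = x (fst (prod_decode j))" using decode[of j] j by (simp add: x')
    then show "dist (x' (Suc j)) (x' (fst (prod_decode j))) \<le> inverse (real (Suc (snd (prod_decode j))))"
      using W near[of j] j by (cases "k = Suc j") (auto simp: attempt_def x')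
  qed
  then show ?thesis using transcript_upd by blast
qed

text \<open>Finite configurations of growing length whose transcripts are prefixes of a single
  \<open>w\<close> need not share their points. Yet every entry of their data stabilizes, the points
  are Cauchy because they approach the same dense points, and the closed conditions pass to the
  limit.\<close>

lemma attempt_limit:
  fixes e :: "nat \<Rightarrow> 'a::complete_space"
  assumes C: "\<And>i n. closed (C i n)"
    and att: "\<forall>\<^sub>F k in sequentially. \<exists>W x. attempt e C k W x \<and> map w [0..<k] = transcript W k"
  shows "\<exists>W x. \<forall>k. attempt e C k W x"
proof -
  have "\<exists>W x. \<forall>\<^sub>F k in sequentially. attempt e C k (W k) (x k) \<and> map w [0..<k] = transcript (W k) k"
    using att unfolding eventually_sequentially by metis
  then obtain V x where
    V: "\<forall>\<^sub>F k in sequentially. attempt e C k (V k) (x k) \<and> map w [0..<k] = transcript (V k) k" by blast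
  define W where "W i j = w (prod_encode (i, j))" for i j
  have ev_W: "\<forall>\<^sub>F k in sequentially. V k i j = W i j" for i j
    using V eventually_gt_at_top[of "prod_encode (i, j)"]
  proof eventually_elim
    case (elim k)
    then have "map w [0..<k] ! prod_encode (i, j) = transcript (V k) k ! prod_encode (i, j)" by simp
    then show ?case using elim by (simp add: transcript_def W_def)
  qed
  have ev_index: "\<forall>\<^sub>F k in sequentially. stage_index (V k i) = stage_index (W i)" for i
    unfolding stage_index_def by (rule ev_W)
  have ev_center: "\<forall>\<^sub>F k in sequentially. stage_center (V k i) m = stage_center (W i) m" for i m
    unfolding stage_center_def by (rule ev_W)
  have lim_witness: "(\<lambda>k. stage_witness (V k l) i) \<longlonglongrightarrow> stage_witness (W l) i" for l i
    unfolding stage_witness_def by (intro tendsto_fun tendsto_eventually ev_W)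
  have dist_x: "\<forall>\<^sub>F k in sequentially. dist (x k i) (e (stage_center (W i) m)) \<le> (1/2) ^ m" for i m
    using V eventually_gt_at_top[of i] ev_center[of i m]
    by eventually_elim (metis attempt_def)
  have "Cauchy (\<lambda>k. x k i)" for i
  proof (rule metric_CauchyI)
    fix r :: real assume "0 < r"
    then obtain m where m: "(1/2) ^ m < r / 2"
      using real_arch_pow_inv[of "r / 2" "1/2"] by auto
    obtain M where M: "\<And>k. k \<ge> M \<Longrightarrow> dist (x k i) (e (stage_center (W i) m)) \<le> (1/2) ^ m"
      using dist_x[of i m] unfolding eventually_sequentially by blast
    have "dist (x k i) (x k' i) < r" if "k \<ge> M" "k' \<ge> M" for k k'
      using M[OF that(1)] M[OF that(2)] m
        dist_triangle2[of "x k i" "x k' i" "e (stage_center (W i) m)"] by linarith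
    then show "\<exists>M. \<forall>k\<ge>M. \<forall>k'\<ge>M. dist (x k i) (x k' i) < r" by blast
  qed
  then have "\<exists>l. (\<lambda>k. x k i) \<longlonglongrightarrow> l" for i
    by (metis Cauchy_convergent convergent_def)
  then obtain X where X: "\<And>i. (\<lambda>k. x k i) \<longlonglongrightarrow> X i" by metis
  have "attempt e C K W X" for K
    unfolding attempt_def
  proof (intro conjI allI impI)
    fix i m
    show "dist (X i) (e (stage_center (W i) m)) \<le> (1/2) ^ m"
      by (rule tendsto_upperbound[OF tendsto_dist[OF X tendsto_const] dist_x]) simp
  next
    fix i l :: nat assume "i < l"
    have "\<forall>\<^sub>F k in sequentially. stage_index (W i) < stage_index (W l)"
      using V eventually_gt_at_top[of l] ev_index[of i] ev_index[of l]
      by eventually_elim (use \<open>i < l\<close> in \<open>metis attempt_def\<close>)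
    then show "stage_index (W i) < stage_index (W l)" by simp
  next
    fix i l :: nat assume "i \<le> l"
    have "\<forall>\<^sub>F k in sequentially. (x k i, stage_witness (V k l) i) \<in> C i (stage_index (W l))"
      using V eventually_gt_at_top[of l] ev_index[of l]
      by eventually_elim (use \<open>i \<le> l\<close> in \<open>metis attempt_def\<close>)
    then show "(X i, stage_witness (W l) i) \<in> C i (stage_index (W l))"
      by (rule Lim_in_closed_set[OF C _ sequentially_bot tendsto_Pair[OF X lim_witness]])
  next
    fix j
    have "\<forall>\<^sub>F k in sequentially. dist (x k (Suc j)) (x k (fst (prod_decode j)))
        \<le> inverse (real (Suc (snd (prod_decode j))))"
      using V eventually_gt_at_top[of "Suc j"]
      by eventually_elim (auto simp: attempt_def)
    then show "dist (X (Suc j)) (X (fst (prod_decode j))) \<le> inverse (real (Suc (snd (prod_decode j))))"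
      by (rule tendsto_upperbound[OF tendsto_dist[OF X X]]) simp
  qed
  then show ?thesis by blast
qed

lemma no_infinite_attempt:
  fixes fs :: "nat \<Rightarrow> 'a::complete_space \<Rightarrow> real"
  assumes "a < b" and fs: "compact (closure (range fs))"
    and baire: "\<And>f. f \<in> cluster_points fs \<Longrightarrow> baire1 f"
    and C: "\<And>i n. fst ` C i n = {x. fs n x \<in> side a b i}"
  shows "\<not> (\<forall>k. attempt e C k W x)"
proof
  assume att: "\<forall>k. attempt e C k W x"
  define n where "n l = stage_index (W l)" for l
  have "strict_mono n"
  proof (rule strict_monoI)
    fix i l :: nat assume "i < l"
    then show "n i < n l" using att[rule_format, of "Suc l"] by (auto simp: attempt_def n_def)
  qed
  have side: "fs (n l) (x i) \<in> side a b i" if "i \<le> l" for i l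
  proof -
    have "(x i, stage_witness (W l) i) \<in> C i (n l)"
      using att[rule_format, of "Suc l"] that by (simp add: attempt_def n_def)
    then have "x i \<in> fst ` C i (n l)" by (metis fst_conv image_eqI)
    then show ?thesis by (simp add: C)
  qed
  have near: "dist (x (Suc j)) (x (fst (prod_decode j))) \<le> inverse (real (Suc (snd (prod_decode j))))" for j
    using att[rule_format, of "Suc (Suc j)"] by (simp add: attempt_def)
  obtain f where f: "f \<in> cluster_points (fs \<circ> n)"
    using compact_cluster_point[OF fs, of "fs \<circ> n"] closure_subset by fastforce
  then have "baire1 f" using baire cluster_points_subseq[OF \<open>strict_mono n\<close>] by blast
  \<comment> \<open>All functions from stage \<open>i\<close> on are on the right side at
    \<open>x i\<close>; the cluster point inherits this only up to closure.\<close>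
  have f_side: "f (x i) \<in> closure (side a b i)" for i
  proof (rule ccontr)
    assume "f (x i) \<notin> closure (side a b i)"
    moreover have "open {g :: 'a \<Rightarrow> real. g (x i) \<in> - closure (side a b i)}"
      by (intro open_coordinate_vimage open_Compl closed_closure)
    ultimately have "infinite {l. (fs \<circ> n) l \<in> {g. g (x i) \<in> - closure (side a b i)}}"
      using f unfolding cluster_points_def by blast
    moreover have "{l. (fs \<circ> n) l \<in> {g. g (x i) \<in> - closure (side a b i)}} \<subseteq> {..<i}"
      using side[of i] closure_subset by (force simp: not_le[symmetric])
    ultimately show False using finite_subset by blast
  qed
  have f_le: "f (x i) \<le> a" if "below i" for i using f_side[of i] that by (simp add: side_def)
  have f_ge: "f (x i) \<ge> b" if "\<not> below i" for i using f_side[of i] that by (simp add: side_def)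
  have dense: "\<exists>j. dist (x j) (x i) < r \<and> (below j \<longleftrightarrow> t)" if "r > 0" for i t and r :: real
  proof -
    obtain m where m: "inverse (real (Suc m)) < r" using reals_Archimedean \<open>r > 0\<close> by blast
    \<comment> \<open>The parity of \<open>m'\<close> selects the side, and \<open>m'\<close> \<ge>
      \<open>m\<close> keeps the point close enough.\<close>
    define m' where "m' = (if t then 2 * m else Suc (2 * m))"
    have "inverse (real (Suc m')) \<le> inverse (real (Suc m))" by (simp add: m'_def)
    moreover have "dist (x (Suc (prod_encode (i, m')))) (x i) \<le> inverse (real (Suc m'))"
      using near[of "prod_encode (i, m')"] by simp
    ultimately have "dist (x (Suc (prod_encode (i, m')))) (x i) < r"
      using m by linarith
    moreover have "below (Suc (prod_encode (i, m'))) \<longleftrightarrow> t" by (simp add: below_def m'_def)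
    ultimately show ?thesis by blast
  qed
  show False
  proof (rule baire1_not_densely_separated[OF \<open>baire1 f\<close> \<open>a < b\<close>])
    show "range x \<noteq> {}" by simp
    show "range x \<subseteq> closure {y \<in> range x. f y \<le> a}"
    proof
      fix y assume "y \<in> range x"
      then obtain i where "y = x i" by blast
      then show "y \<in> closure {y \<in> range x. f y \<le> a}"
        using dense[of _ i True] f_le by (fastforce simp: closure_approachable)
    qed
    show "range x \<subseteq> closure {y \<in> range x. f y \<ge> b}"
    proof
      fix y assume "y \<in> range x"
      then obtain i where "y = x i" by blast
      then show "y \<in> closure {y \<in> range x. f y \<ge> b}"
        using dense[of _ i False] f_ge by (fastforce simp: closure_approachable)
    qed
  qed
qed

subsection \<open>The uniform bound\<close>

lemma open_side: "open (side a b i)"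
  by (simp add: side_def)

lemma sep_deriv_subset_closure_side:
  "sep_deriv f a b F \<subseteq> closure (F \<inter> {x. f x \<in> side a b i})"
  by (auto simp: sep_deriv_def side_def)

text \<open>Finitely many side conditions define an open neighbourhood of \<open>f\<close> in the
  pointwise topology.\<close>

lemma cluster_point_frequently_side:
  fixes fs :: "nat \<Rightarrow> 'a \<Rightarrow> real"
  assumes "f \<in> cluster_points fs" "\<And>i. i \<le> k \<Longrightarrow> f (x i) \<in> side a b i"
  shows "\<exists>n>N. \<forall>i\<le>k. fs n (x i) \<in> side a b i"
proof -
  have "open {g :: 'a \<Rightarrow> real. \<forall>i\<in>{..k}. g (x i) \<in> side a b i}"
    by (rule product_topology_basis') (auto intro: open_side)
  then have "infinite {n. fs n \<in> {g. \<forall>i\<in>{..k}. g (x i) \<in> side a b i}}"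
    using assms unfolding cluster_points_def by blast
  then show ?thesis by (simp add: infinite_nat_iff_unbounded Ball_def)
qed

theorem cluster_points_rank_bounded:
  fixes fs :: "nat \<Rightarrow> 'a::polish_space \<Rightarrow> real"
  assumes borel: "\<And>n. fs n \<in> borel_measurable borel"
    and compact: "compact (closure (range fs))"
    and baire: "\<And>f. f \<in> cluster_points fs \<Longrightarrow> baire1 f"
  obtains r :: "(nat \<times> nat) set" where "Well_order r" "\<And>f. f \<in> cluster_points fs \<Longrightarrow> sep_rank_le f r"
proof -
  obtain D :: "'a set" where D: "countable D" "\<And>X. open X \<Longrightarrow> X \<noteq> {} \<Longrightarrow> \<exists>d\<in>D. d \<in> X"
    using countable_dense_setE by blast
  define e where "e = from_nat_into D"
  have "D \<noteq> {}" using D(2)[of UNIV] by auto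
  then have "range e = D" using D(1) by (simp add: e_def range_from_nat_into)
  have e: "closure (range e) = UNIV"
  proof (rule ccontr)
    assume "closure (range e) \<noteq> UNIV"
    then have "- closure (range e) \<noteq> {}" by blast
    moreover have "open (- closure (range e))" by (intro open_Compl closed_closure)
    ultimately obtain d where "d \<in> D" "d \<in> - closure (range e)" using D(2) by meson
    then show False using \<open>range e = D\<close> closure_subset[of "range e"] by blast
  qed
  have closed_projection: "\<exists>C :: ('a \<times> (nat \<Rightarrow> nat)) set. closed C \<and> {x. fs n x \<in> side a b i} = fst ` C" for a b i n
  proof -
    have "fs n -` side a b i \<inter> space borel \<in> sets borel"
      by (intro measurable_sets[OF borel] borel_open open_side)
    then have "analytic_set {x. fs n x \<in> side a b i}"
      by (intro analytic_set_borel) (simp add: vimage_def)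
    then show ?thesis by (simp add: analytic_set_def)
  qed
  define C :: "real \<Rightarrow> real \<Rightarrow> nat \<Rightarrow> nat \<Rightarrow> ('a \<times> (nat \<Rightarrow> nat)) set" where
    "C a b i n = (SOME C. closed C \<and> {x. fs n x \<in> side a b i} = fst ` C)" for a b i n
  have C: "closed (C a b i n)" "fst ` C a b i n = {x. fs n x \<in> side a b i}" for a b i n
    using someI_ex[OF closed_projection[of n a b i]] by (auto simp: C_def)
  \<comment> \<open>The rational pair is part of the node, so a single tree, and hence a single
    well-order, handles all pairs. Demanding a < b excludes infinite branches for the other
    pairs.\<close>
  define T :: "rat \<times> rat \<Rightarrow> nat list \<Rightarrow> bool" where
    "T p s \<longleftrightarrow> fst p < snd p \<and>
      (\<exists>k W x. attempt e (C (of_rat (fst p)) (of_rat (snd p))) k W x \<and> s = transcript W k)" for p s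
  define R0 where "R0 = {((p, s @ [c]), (p, s)) | p s c. T p (s @ [c])}"
  have "\<exists>\<^sub>F k in sequentially. \<not> T p (map w [0..<k])" for p w
  proof -
    have False if "\<forall>\<^sub>F k in sequentially. T p (map w [0..<k])"
    proof -
      define a b where "a = (of_rat (fst p) :: real)" and "b = (of_rat (snd p) :: real)"
      have "\<exists>k. T p (map w [0..<k])" using that by (auto simp: eventually_sequentially)
      then have "a < b" by (auto simp: T_def a_def b_def of_rat_less)
      have "\<forall>\<^sub>F k in sequentially. \<exists>W x. attempt e (C a b) k W x \<and> map w [0..<k] = transcript W k"
        using that
      proof eventually_elim
        case (elim k)
        then obtain k' W x where "attempt e (C a b) k' W x" "map w [0..<k] = transcript W k'"
          by (auto simp: T_def a_def b_def)
        \<comment> \<open>The length of a transcript recovers the number of stages.\<close>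
        moreover from this(2) have "length (map w [0..<k]) = length (transcript W k')" by (rule arg_cong)
        then have "k = k'" by (simp add: transcript_def)
        ultimately show ?case by blast
      qed
      then have "\<exists>W x. \<forall>k. attempt e (C a b) k W x" by (rule attempt_limit[OF C(1)])
      then show False using no_infinite_attempt[OF \<open>a < b\<close> compact baire C(2)] by blast
    qed
    then show ?thesis unfolding frequently_def by auto
  qed
  then have "wf R0" unfolding R0_def by (rule wf_list_extension)
  then have "wf (map_prod to_nat to_nat ` R0)" by (rule wf_map_prod_image) simp
  then obtain r where r: "Well_order r" "map_prod to_nat to_nat ` R0 \<subseteq> r - Id" "Field r = UNIV"
    by (rule wf_extends_to_Well_order)
  have wf_r: "wf (r - Id)" using r(1) by (simp add: well_order_on_def)
  have trans_r: "(i, k) \<in> r - Id" if "(i, j) \<in> r - Id" "(j, k) \<in> r - Id" for i j k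
  proof -
    have "trans r" "antisym r"
      using r(1)
      by (simp_all add: well_order_on_def linear_order_on_def partial_order_on_def preorder_on_def)
    moreover have "(i, j) \<in> r" "(j, k) \<in> r" "i \<noteq> j" using that by auto
    ultimately have "(i, k) \<in> r" "i \<noteq> k" by (meson transD, meson antisymD)
    then show ?thesis by simp
  qed
  have "sep_iter_empty r f a b UNIV" if f: "f \<in> cluster_points fs" and ab: "a \<in> \<rat>" "b \<in> \<rat>" "a < b" for f a b
    unfolding sep_iter_empty_def
  proof (intro allI impI)
    fix F assume tower: "sep_tower r f a b UNIV F"
    have F: "z \<in> F i \<longleftrightarrow> (\<forall>j. (j, i) \<in> r - Id \<longrightarrow> z \<in> sep_deriv f a b (F j))" for i z
    proof -
      have "F i = UNIV \<inter> (\<Inter>j\<in>{j. (j, i) \<in> r \<and> j \<noteq> i}. sep_deriv f a b (F j))"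
        using tower r(3) unfolding sep_tower_def by blast
      then have "z \<in> F i \<longleftrightarrow> z \<in> (\<Inter>j\<in>{j. (j, i) \<in> r \<and> j \<noteq> i}. sep_deriv f a b (F j))"
        by simp
      also have "\<dots> \<longleftrightarrow> (\<forall>j. (j, i) \<in> r - Id \<longrightarrow> z \<in> sep_deriv f a b (F j))" by auto
      finally show ?thesis .
    qed
    obtain p :: "rat \<times> rat" where p: "a = of_rat (fst p)" "b = of_rat (snd p)"
      using ab(1,2) by (metis Rats_cases fst_conv snd_conv)
    define code where "code s = to_nat (p, s :: nat list)" for s
    have extend: "\<exists>W'. attempt e (C a b) (Suc k) W' (x(k := y)) \<and>
        (code (transcript W' (Suc k)), code (transcript W k)) \<in> r - Id"
      if att: "attempt e (C a b) k W x"
        and f_side: "\<And>i. i \<le> k \<Longrightarrow> f ((x(k := y)) i) \<in> side a b i"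
        and near: "\<And>j. k = Suc j \<Longrightarrow> dist y (x (fst (prod_decode j))) \<le> inverse (real (Suc (snd (prod_decode j))))"
      for k W x y
    proof -
      have "\<exists>n>N. \<forall>i\<le>k. (x(k := y)) i \<in> fst ` C a b i n" for N
        using cluster_point_frequently_side[OF f f_side] unfolding C(2) by blast
      then obtain W' where W': "attempt e (C a b) (Suc k) W' (x(k := y))"
        "take k (transcript W' (Suc k)) = transcript W k"
        using attempt_extend[OF att refl e near] by blast
      have "length (transcript W' (Suc k)) = Suc k" by (simp add: transcript_def)
      then have split: "transcript W' (Suc k) = transcript W k @ [transcript W' (Suc k) ! k]"
        using take_Suc_conv_app_nth[of k "transcript W' (Suc k)"] W'(2) by simp
      have "T p (transcript W' (Suc k))" using W'(1) ab(3) p by (auto simp: T_def of_rat_less)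
      moreover have "((p, s @ [c]), (p, s)) \<in> R0" if "T p (s @ [c])" for s c
        using that unfolding R0_def by blast
      ultimately have "((p, transcript W' (Suc k)), (p, transcript W k)) \<in> R0"
        using split by metis
      then have "(code (transcript W' (Suc k)), code (transcript W k)) \<in> map_prod to_nat to_nat ` R0"
        unfolding code_def by (rule map_prod_imageI)
      then have "(code (transcript W' (Suc k)), code (transcript W k)) \<in> r - Id"
        using r(2) by (rule subsetD[rotated])
      with W'(1) show ?thesis by (intro exI conjI)
    qed
    \<comment> \<open>The descent: if \<open>t < v\<close>, points of \<open>F v\<close> lie in the derivative of \<open>F t\<close>, so an attempt with
      code \<open>t\<close> and points in \<open>F v\<close> extends to one with code \<open>t' < t\<close> and points in \<open>F t\<close>.\<close>
    have no_attempt: "\<not> (attempt e (C a b) (Suc k) W x \<and> (\<forall>i\<le>k. x i \<in> F v \<and> f (x i) \<in> side a b i) \<and>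
        (code (transcript W (Suc k)), v) \<in> r - Id)" for v k W x
      using wf_r
    proof (induction v arbitrary: k W x)
      case (less v)
      show ?case
      proof
        define t where "t = code (transcript W (Suc k))"
        assume "attempt e (C a b) (Suc k) W x \<and> (\<forall>i\<le>k. x i \<in> F v \<and> f (x i) \<in> side a b i) \<and>
          (code (transcript W (Suc k)), v) \<in> r - Id"
        then have att: "attempt e (C a b) (Suc k) W x" "\<And>i. i \<le> k \<Longrightarrow> x i \<in> F v"
          "\<And>i. i \<le> k \<Longrightarrow> f (x i) \<in> side a b i" "(t, v) \<in> r - Id"
          by (auto simp: t_def)
        have "fst (prod_decode k) \<le> k"
          using le_prod_encode_1[of "fst (prod_decode k)" "snd (prod_decode k)"] by simp
        then have "x (fst (prod_decode k)) \<in> F v" by (rule att(2))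
        then have "x (fst (prod_decode k)) \<in> sep_deriv f a b (F t)"
          using att(4) F by metis
        then have "x (fst (prod_decode k)) \<in> closure (F t \<inter> {x. f x \<in> side a b (Suc k)})"
          using sep_deriv_subset_closure_side by blast
        moreover have "0 < inverse (real (Suc (snd (prod_decode k))))" by simp
        ultimately obtain y where "y \<in> F t \<inter> {x. f x \<in> side a b (Suc k)}"
          and dist_y: "dist y (x (fst (prod_decode k))) < inverse (real (Suc (snd (prod_decode k))))"
          unfolding closure_approachable by blast
        then have y: "y \<in> F t" "f y \<in> side a b (Suc k)" by auto
        have near: "dist y (x (fst (prod_decode j))) \<le> inverse (real (Suc (snd (prod_decode j))))"
          if "Suc k = Suc j" for j
          using that dist_y by simp
        define x' where "x' = x(Suc k := y)"
        have f_x': "f (x' i) \<in> side a b i" if "i \<le> Suc k" for i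
          using that att(3) y(2) by (auto simp: x'_def le_Suc_eq)
        \<comment> \<open>Predecessors of \<open>t\<close> are predecessors of \<open>v\<close>, so
          the old points remain usable one level lower.\<close>
        have "F v \<subseteq> F t"
        proof
          fix z assume "z \<in> F v"
          then show "z \<in> F t" using F trans_r[OF _ att(4)] by metis
        qed
        then have F_x': "x' i \<in> F t" if "i \<le> Suc k" for i
          using that att(2) y(1) by (auto simp: x'_def le_Suc_eq)
        obtain W' where "attempt e (C a b) (Suc (Suc k)) W' x'"
          "(code (transcript W' (Suc (Suc k))), t) \<in> r - Id"
          using extend[OF att(1) f_x'[unfolded x'_def] near] unfolding x'_def t_def by blast
        then show False using less[OF att(4), of "Suc k" W' x'] F_x' f_x' by blast
      qed
    qed
    show "UNIV \<inter> (\<Inter>j\<in>Field r. sep_deriv f a b (F j)) = {}"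
    proof (rule ccontr)
      assume "UNIV \<inter> (\<Inter>j\<in>Field r. sep_deriv f a b (F j)) \<noteq> {}"
      \<comment> \<open>The field of \<open>r\<close> is all of the naturals, so it contains the
        code of the empty list; a surviving point starts the descent there.\<close>
      then obtain z where "z \<in> sep_deriv f a b (F (code []))" using r(3) by auto
      then have "z \<in> closure (F (code []) \<inter> {x. f x \<in> side a b 0})"
        by (rule subsetD[OF sep_deriv_subset_closure_side])
      then have "F (code []) \<inter> {x. f x \<in> side a b 0} \<noteq> {}" by (metis closure_empty empty_iff)
      then obtain y where y: "y \<in> F (code [])" "f y \<in> side a b 0" by auto
      \<comment> \<open>With no stages every clause of \<open>attempt\<close> is vacuous, so the
        initial data and points are arbitrary.\<close>
      obtain W' where "attempt e (C a b) (Suc 0) W' ((\<lambda>_. y)(0 := y))"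
        "(code (transcript W' (Suc 0)), code []) \<in> r - Id"
        using extend[of 0 "\<lambda>_ _. 0" "\<lambda>_. y" y] y(2) by (auto simp: attempt_def transcript_def)
      then show False using no_attempt[of 0 W' "(\<lambda>_. y)(0 := y)" "code []"] y by simp
    qed
  qed
  then show thesis using that[OF r(1)] by (simp add: sep_rank_le_def)
qed

section \<open>Reduction of both assertions to cluster points of a sequence\<close>

theorem theorem4p8:
  fixes dummy :: "'a::polish_space"
  shows
   "(\<forall>fs :: nat \<Rightarrow> 'a \<Rightarrow> real.
       (\<forall>n. fs n \<in> borel_measurable borel) \<and>
       compact (closure (range fs)) \<and>
       (\<forall>f. f islimpt closure (range fs) \<longrightarrow> baire1 f)
     \<longrightarrow> (\<exists>r :: (nat \<times> nat) set. Well_order r \<and>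
            (\<forall>f. f islimpt closure (range fs) \<longrightarrow> sep_rank_le f r)))
    \<and>
    (\<forall>K :: ('a \<Rightarrow> real) set.
       rosenthal_compact K \<and> separable_set K
     \<longrightarrow> (\<exists>r :: (nat \<times> nat) set. Well_order r \<and> (\<forall>f\<in>K. sep_rank_le f r)))"
proof (intro conjI allI impI)
  fix fs :: "nat \<Rightarrow> 'a \<Rightarrow> real"
  assume "(\<forall>n. fs n \<in> borel_measurable borel) \<and> compact (closure (range fs)) \<and>
    (\<forall>f. f islimpt closure (range fs) \<longrightarrow> baire1 f)"
  then have fs: "\<And>n. fs n \<in> borel_measurable borel" "compact (closure (range fs))"
    "\<And>f. f islimpt range fs \<Longrightarrow> baire1 f"
    by (auto simp: islimpt_closure_iff)
  show "\<exists>r :: (nat \<times> nat) set. Well_order r \<and> (\<forall>f. f islimpt closure (range fs) \<longrightarrow> sep_rank_le f r)"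
  proof (cases "finite (range fs)")
    case True
    then have "\<not> f islimpt closure (range fs)" for f
      by (simp add: islimpt_closure_iff islimpt_finite)
    moreover have "Well_order ({} :: (nat \<times> nat) set)" by simp
    ultimately show ?thesis by blast
  next
    case False
    \<comment> \<open>Enumerating without repetition makes cluster points and accumulation points
      coincide. A function repeated infinitely often in \<open>fs\<close> would be a cluster point
      without being known to be Baire-1.\<close>
    define gs where "gs = from_nat_into (range fs)"
    have bij: "bij_betw gs UNIV (range fs)"
      unfolding gs_def using False by (intro bij_betw_from_nat_into) auto
    then have range_gs: "range gs = range fs" and inj_gs: "inj gs" by (auto simp: bij_betw_def)
    have cluster: "f \<in> cluster_points gs \<longleftrightarrow> f islimpt range fs" for f
    proof -
      have "U \<inter> range gs = gs ` {n. gs n \<in> U}" for U by auto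
      then have "finite (U \<inter> range gs) \<longleftrightarrow> finite {n. gs n \<in> U}" for U
        using inj_gs by (simp add: finite_image_iff inj_on_subset)
      then show ?thesis
        by (auto simp: cluster_points_def islimpt_eq_acc_point range_gs[symmetric])
    qed
    obtain r :: "(nat \<times> nat) set" where "Well_order r"
      "\<And>f. f \<in> cluster_points gs \<Longrightarrow> sep_rank_le f r"
    proof (rule cluster_points_rank_bounded[of gs])
      show "gs n \<in> borel_measurable borel" for n
        using fs(1) range_gs by (metis rangeE rangeI)
    qed (use fs range_gs cluster in auto)
    then show ?thesis by (auto simp: islimpt_closure_iff cluster)
  qed
next
  fix K :: "('a \<Rightarrow> real) set"
  assume "rosenthal_compact K \<and> separable_set K"
  then obtain D where K: "\<And>f. f \<in> K \<Longrightarrow> baire1 f" "compact K"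
    and D: "countable D" "D \<subseteq> K" "K \<subseteq> closure D"
    by (auto simp: rosenthal_compact_def separable_set_def)
  show "\<exists>r :: (nat \<times> nat) set. Well_order r \<and> (\<forall>f\<in>K. sep_rank_le f r)"
  proof (cases "K = {}")
    case True
    moreover have "Well_order ({} :: (nat \<times> nat) set)" by simp
    ultimately show ?thesis by blast
  next
    case False
    then have "D \<noteq> {}" using D(3) by auto
    have closure_D: "closure D = K"
      using D compact_imp_closed[OF K(2)] closure_minimal by blast
    \<comment> \<open>Here each member of \<open>D\<close> is repeated infinitely often, so that
      isolated points of \<open>K\<close> also become cluster points.\<close>
    define gs where "gs n = from_nat_into D (fst (prod_decode n))" for n
    have in_D: "gs n \<in> D" for n using \<open>D \<noteq> {}\<close> by (simp add: gs_def from_nat_into)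
    have repeat: "infinite {n. gs n = d}" if d: "d \<in> D" for d
    proof -
      obtain i where i: "from_nat_into D i = d"
        using from_nat_into_surj[OF D(1) d] by blast
      have "infinite (range (\<lambda>j. prod_encode (i, j)))"
        by (intro range_inj_infinite) (simp add: inj_on_def)
      then show ?thesis by (rule infinite_super[rotated]) (auto simp: gs_def i)
    qed
    then have range_gs: "range gs = D"
      using in_D by (force dest: infinite_imp_nonempty)
    have cluster: "f \<in> cluster_points gs \<longleftrightarrow> f \<in> K" for f
    proof
      show "f \<in> K" if "f \<in> cluster_points gs"
        using cluster_point_in_closure[OF that] by (simp add: range_gs closure_D)
    next
      assume "f \<in> K"
      have "infinite {n. gs n \<in> U}" if U: "open U" "f \<in> U" for U
      proof -
        have "U \<inter> closure D \<noteq> {}" using U(2) \<open>f \<in> K\<close> closure_D by blast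
        then obtain d where "d \<in> U" "d \<in> D"
          unfolding open_Int_closure_eq_empty[OF U(1)] by blast
        then have "{n. gs n = d} \<subseteq> {n. gs n \<in> U}" by blast
        then show ?thesis using repeat[OF \<open>d \<in> D\<close>] by (rule infinite_super)
      qed
      then show "f \<in> cluster_points gs" by (simp add: cluster_points_def)
    qed
    obtain r :: "(nat \<times> nat) set" where "Well_order r"
      "\<And>f. f \<in> cluster_points gs \<Longrightarrow> sep_rank_le f r"
    proof (rule cluster_points_rank_bounded[of gs])
      show "gs n \<in> borel_measurable borel" for n
        using in_D D(2) K(1) baire1_borel_measurable by blast
    qed (use K cluster range_gs closure_D in auto)
    then show ?thesis by (auto simp: cluster)
  qed
qed

end
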